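(* For every integer $n\ge 3$, $$[-1,1]\cup\Pi_3\cup\Pi_4\cup\cdots\cup\Pi_{\left[\frac n2\right]}\cup\Pi^0_{\left[\frac{n+1}{2}\right]}\cup\Pi_n\subseteq\Lambda(\mathrm{PDS}_n),$$ where $\Pi_3\cup\cdots\cup\Pi_{[n/2]}$ denotes the union of $\Pi_m$ over integers $3\le m\le [n/2]$.
   Context: A real matrix is doubly stochastic if its entries are nonnegative and every row and column sums to $1$. A matrix is permutative if every row is a permutation of its first row. $\mathrm{PDS}_n$ is the set of all $n\times n$ matrices that are both permutative and doubly stochastic. For a set $S$ of matrices, $\Lambda(S)\subseteq\mathbb{C}$ is the set of all complex numbers that are eigenvalues of some matrix in $S$. $\Pi_j\subseteq\mathbb{C}$ is the convex hull of the $j$-th roots of unity, and $\Pi_j^0$ is the union of $\{1\}$ and the convex hull of the $j$-th roots of unity other than $1$. $[x]$ denotes the integer part of $x$. *)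

theory Defs
  imports
    "HOL-Analysis.Convex"
    "HOL-Combinatorics.Permutations"
    "Jordan_Normal_Form.Char_Poly"
begin

definition doubly_stochastic :: "real mat \<Rightarrow> bool" where
  "doubly_stochastic A \<longleftrightarrow>
     square_mat A \<and>
     (\<forall>i<dim_row A. \<forall>j<dim_col A. 0 \<le> A $$ (i, j)) \<and>
     (\<forall>i<dim_row A. (\<Sum>j<dim_col A. A $$ (i, j)) = 1) \<and>
     (\<forall>j<dim_col A. (\<Sum>i<dim_row A. A $$ (i, j)) = 1)"

definition permutative :: "'a mat \<Rightarrow> bool" where
  "permutative A \<longleftrightarrow>
     (\<forall>i<dim_row A. \<exists>p. p permutes {..<dim_col A} \<and>
        (\<forall>j<dim_col A. A $$ (i, j) = A $$ (0, p j)))"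

definition PDS :: "nat \<Rightarrow> real mat set" where
  "PDS n = {A \<in> carrier_mat n n. permutative A \<and> doubly_stochastic A}"

definition eigenvalue_region :: "real mat set \<Rightarrow> complex set" where
  "eigenvalue_region S = {z. \<exists>A\<in>S. eigenvalue (map_mat complex_of_real A) z}"

definition roots_hull :: "nat \<Rightarrow> complex set" where
  "roots_hull j = convex hull {z. z ^ j = 1}"

definition roots_hull0 :: "nat \<Rightarrow> complex set" where
  "roots_hull0 j = {1} \<union> convex hull {z. z ^ j = 1 \<and> z \<noteq> 1}"

end

theory Submission
  imports Defs "HOL-Number_Theory.Cong"
begin

text \<open>
  Take permutations \<open>\<sigma>\<^sub>k\<close> of \<open>{..<n}\<close>, no two of which agree at any point. In the matrix
  \<open>\<Sum>\<^sub>k c\<^sub>k P(\<sigma>\<^sub>k)\<close> the permutation matrices then never overlap, so every row consists of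
  the weights \<open>c\<^sub>k\<close> and some zeros, in some order. If the weights are convex, the matrix is
  therefore permutative as well as doubly stochastic (lemma
  \<open>permutation_mixture_in_PDS\<close>). It acts on a vector by
  \<open>(A v)(i) = \<Sum>\<^sub>k c\<^sub>k v(\<sigma>\<^sub>k i)\<close>, so eigenvectors can be read off from the permutations
  (lemma \<open>permutation_mixture_eigenvalue\<close>). All parts of the region come from two choices.

  For the hulls of the \<open>m\<close>-th roots of unity, \<open>\<sigma>\<^sub>k\<close> rotates the block \<open>{..<m}\<close> by \<open>k\<close> and also
  rotates the block \<open>{m..<n}\<close> by \<open>k\<close>. For an \<open>m\<close>-th root of unity \<open>w\<close>, the vector
  \<open>(1, w, \<dots>, w\<^sup>m\<^sup>-\<^sup>1, 0, \<dots>, 0)\<close> is an eigenvector to \<open>\<Sum>\<^sub>k c\<^sub>k w\<^sup>k\<close>. With \<open>w\<close> primitive and \<open>k\<close>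
  ranging over \<open>K \<subseteq> {..<m}\<close>, these values fill the convex hull of the powers \<open>w\<^sup>k\<close> with
  \<open>k \<in> K\<close>. The rotations of the second block must be distinct, that is, \<open>K\<close> must be injective
  modulo \<open>n - m\<close>. For all roots, \<open>K = {..<m}\<close>, this holds if \<open>2 m \<le> n\<close> or the second block is empty.
  Omitting the root \<open>1\<close> removes \<open>0\<close> from \<open>K\<close>, and then a second block of length \<open>m - 1\<close> is
  enough, so that \<open>m\<close> may be as large as \<open>(n + 1) / 2\<close>.

  For real \<open>x \<in> [-1, 1]\<close>, the matrix is \<open>\<bar>x\<bar> P(\<tau>) + (1 - \<bar>x\<bar>) J / n\<close> with \<open>J\<close> the
  all-ones matrix, and \<open>\<tau>\<close> the identity or the transposition of \<open>0\<close> and \<open>1\<close>, depending on the sign of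
  \<open>x\<close>. The vector \<open>e\<^sub>0 - e\<^sub>1\<close> is killed by \<open>J\<close> and multiplied by \<open>\<plusminus>1\<close> by \<open>P(\<tau>)\<close>.
\<close>

section \<open>Mixtures of permutation matrices with disjoint supports\<close>

definition permutation_mixture ::
    "nat \<Rightarrow> 'k set \<Rightarrow> ('k \<Rightarrow> nat \<Rightarrow> nat) \<Rightarrow> ('k \<Rightarrow> real) \<Rightarrow> real mat" where
  "permutation_mixture n K \<sigma> c = mat n n (\<lambda>(i, j). \<Sum>k\<in>K. if \<sigma> k i = j then c k else 0)"

text \<open>
  A row of a mixture places the weight \<open>c k\<close> at the column \<open>f k\<close>. As multisets, any two rows
  agree because the right-hand side does not mention the placement \<open>f\<close>.
\<close>

lemma mset_scattered_weights:
  fixes f :: "'k \<Rightarrow> 'i" and c :: "'k \<Rightarrow> 'w::comm_monoid_add"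
  assumes "finite S" and "finite K" and "inj_on f K" and "f ` K \<subseteq> S"
  shows "image_mset (\<lambda>j. \<Sum>k\<in>K. if f k = j then c k else 0) (mset_set S)
       = image_mset c (mset_set K) + replicate_mset (card S - card K) 0"
proof -
  let ?w = "\<lambda>j. \<Sum>k\<in>K. if f k = j then c k else 0"
  have on: "?w (f k) = c k" if "k \<in> K" for k
  proof -
    have "?w (f k) = (\<Sum>k'\<in>K. if k' = k then c k' else 0)"
      using that assms(3) by (intro sum.cong) (auto simp: inj_on_def)
    then show ?thesis using that assms(2) by simp
  qed
  have off: "?w j = 0" if "j \<in> S - f ` K" for j
    using that by (intro sum.neutral) auto
  have "mset_set S = mset_set (f ` K) + mset_set (S - f ` K)"
    using assms by (metis Diff_disjoint Diff_partition finite_Diff finite_imageI mset_set_Union)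
  moreover have "image_mset ?w (mset_set (f ` K)) = image_mset c (mset_set K)"
  proof -
    have "image_mset ?w (mset_set (f ` K)) = image_mset (\<lambda>k. ?w (f k)) (mset_set K)"
      by (simp flip: image_mset_mset_set[OF assms(3)] add: multiset.map_comp comp_def)
    also have "\<dots> = image_mset c (mset_set K)"
      using on assms(2) by (intro image_mset_cong) auto
    finally show ?thesis .
  qed
  moreover have "image_mset ?w (mset_set (S - f ` K)) = replicate_mset (card S - card K) 0"
  proof -
    have "image_mset ?w (mset_set (S - f ` K)) = image_mset (\<lambda>_. 0) (mset_set (S - f ` K))"
      using off assms(1) by (intro image_mset_cong) auto
    also have "\<dots> = replicate_mset (card (S - f ` K)) 0"
      using assms(1) by (simp add: image_mset_const_eq)
    finally show ?thesis
      using assms by (simp add: card_Diff_subset card_image)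
  qed
  ultimately show ?thesis by simp
qed

text \<open>
  Rows are rearrangements of each other since the injectivity of \<open>k \<mapsto> \<sigma> k i\<close> keeps the
  weights in distinct columns. Column sums are \<open>1\<close> since each \<open>\<sigma> k\<close> hits every column exactly once.
\<close>

lemma permutation_mixture_in_PDS:
  assumes K: "finite K"
    and bij: "\<And>k. k \<in> K \<Longrightarrow> bij_betw (\<sigma> k) {..<n} {..<n}"
    and disj: "\<And>i. i < n \<Longrightarrow> inj_on (\<lambda>k. \<sigma> k i) K"
    and c: "\<And>k. k \<in> K \<Longrightarrow> c k \<ge> 0" and c1: "sum c K = 1"
  shows "permutation_mixture n K \<sigma> c \<in> PDS n"
proof -
  let ?A = "permutation_mixture n K \<sigma> c"
  let ?w = "\<lambda>i j. \<Sum>k\<in>K. if \<sigma> k i = j then c k else 0"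
  have maps: "\<sigma> k i < n" if "k \<in> K" "i < n" for k i
    using bij[OF that(1)] that(2) by (auto simp: bij_betw_def)
  have entry: "?A $$ (i, j) = ?w i j" if "i < n" "j < n" for i j
    using that by (auto simp: permutation_mixture_def)
  have dim: "dim_row ?A = n" "dim_col ?A = n"
    by (auto simp: permutation_mixture_def)
  have row_mset: "image_mset (?w i) (mset_set {..<n})
      = image_mset c (mset_set K) + replicate_mset (n - card K) 0" if "i < n" for i
    using mset_scattered_weights[of "{..<n}" K "\<lambda>k. \<sigma> k i" c] K disj[OF that] maps that
    by auto
  have "permutative ?A"
    unfolding permutative_def dim
  proof (intro allI impI)
    fix i assume i: "i < n"
    then have "image_mset (?w i) (mset_set {..<n}) = image_mset (?w 0) (mset_set {..<n})"
      using row_mset[of 0] row_mset[of i] by simp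
    then obtain p where "p permutes {..<n}" "\<forall>j\<in>{..<n}. ?w i j = ?w 0 (p j)"
      using image_mset_eq_implies_permutes[of "{..<n}" "?w i" "?w 0"] by auto
    then show "\<exists>p. p permutes {..<n} \<and> (\<forall>j<n. ?A $$ (i, j) = ?A $$ (0, p j))"
      using i by (intro exI[of _ p]) (auto simp: entry permutes_in_image[of p "{..<n}", unfolded lessThan_iff])
  qed
  moreover have "doubly_stochastic ?A"
    unfolding doubly_stochastic_def dim
  proof (intro conjI allI impI)
    show "square_mat ?A" using dim by simp
    show "0 \<le> ?A $$ (i, j)" if "i < n" "j < n" for i j
      using that c by (auto simp: entry intro!: sum_nonneg)
    show "(\<Sum>j<n. ?A $$ (i, j)) = 1" if i: "i < n" for i
    proof -
      have "(\<Sum>j<n. ?A $$ (i, j)) = (\<Sum>j<n. ?w i j)"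
        using i by (intro sum.cong) (auto simp: entry)
      also have "\<dots> = (\<Sum>k\<in>K. \<Sum>j<n. if \<sigma> k i = j then c k else 0)"
        by (rule sum.swap)
      also have "\<dots> = sum c K"
        using maps i by (intro sum.cong) auto
      finally show ?thesis using c1 by simp
    qed
    show "(\<Sum>i<n. ?A $$ (i, j)) = 1" if j: "j < n" for j
    proof -
      have "(\<Sum>i<n. ?A $$ (i, j)) = (\<Sum>i<n. ?w i j)"
        using j by (intro sum.cong) (auto simp: entry)
      also have "\<dots> = (\<Sum>k\<in>K. \<Sum>i<n. if \<sigma> k i = j then c k else 0)"
        by (rule sum.swap)
      also have "\<dots> = (\<Sum>k\<in>K. \<Sum>i<n. if i = j then c k else 0)"
        by (rule sum.cong[OF refl], rule sum.reindex_bij_betw[OF bij])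
      also have "\<dots> = sum c K"
        using j by (intro sum.cong) auto
      finally show ?thesis using c1 by simp
    qed
  qed
  ultimately show ?thesis
    by (simp add: PDS_def permutation_mixture_def)
qed

lemma permutation_mixture_eigenvalue:
  fixes v :: "nat \<Rightarrow> complex"
  assumes "finite K"
    and "\<And>k. k \<in> K \<Longrightarrow> bij_betw (\<sigma> k) {..<n} {..<n}"
    and "\<And>i. i < n \<Longrightarrow> inj_on (\<lambda>k. \<sigma> k i) K"
    and "\<And>k. k \<in> K \<Longrightarrow> c k \<ge> 0" and "sum c K = 1"
    and v0: "i0 < n" "v i0 \<noteq> 0"
    and eig: "\<And>i. i < n \<Longrightarrow> (\<Sum>k\<in>K. of_real (c k) * v (\<sigma> k i)) = z * v i"
  shows "z \<in> eigenvalue_region (PDS n)"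
proof -
  let ?A = "permutation_mixture n K \<sigma> c"
  let ?B = "map_mat complex_of_real ?A"
  have "vec n v \<noteq> 0\<^sub>v n"
    using v0 by (metis index_vec index_zero_vec(1))
  moreover have "?B *\<^sub>v vec n v = z \<cdot>\<^sub>v vec n v"
  proof (rule eq_vecI)
    fix i assume "i < dim_vec (z \<cdot>\<^sub>v vec n v)"
    then have i: "i < n" by simp
    have "(?B *\<^sub>v vec n v) $ i
        = (\<Sum>j<n. (\<Sum>k\<in>K. if \<sigma> k i = j then of_real (c k) else 0) * v j)"
      using i by (auto simp: permutation_mixture_def scalar_prod_def atLeast0LessThan
          of_real_sum if_distrib[of complex_of_real] intro!: sum.cong)
    also have "\<dots> = (\<Sum>j<n. \<Sum>k\<in>K. if \<sigma> k i = j then of_real (c k) * v j else 0)"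
      unfolding sum_distrib_right by (intro sum.cong) auto
    also have "\<dots> = (\<Sum>k\<in>K. \<Sum>j<n. if \<sigma> k i = j then of_real (c k) * v j else 0)"
      by (rule sum.swap)
    also have "\<dots> = (\<Sum>k\<in>K. of_real (c k) * v (\<sigma> k i))"
      using assms(2) i by (intro sum.cong) (auto simp: bij_betw_def)
    finally show "(?B *\<^sub>v vec n v) $ i = (z \<cdot>\<^sub>v vec n v) $ i"
      using eig[OF i] i by simp
  qed (simp add: permutation_mixture_def)
  ultimately have "eigenvalue ?B z"
    unfolding eigenvalue_def eigenvector_def
    by (intro exI[of _ "vec n v"]) (simp add: permutation_mixture_def)
  then show ?thesis
    using permutation_mixture_in_PDS[OF assms(1-5)] by (auto simp: eigenvalue_region_def)
qed

section \<open>Rotating two blocks\<close>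

lemma inj_on_shift_mod:
  fixes a q :: nat
  assumes "inj_on (\<lambda>k. k mod q) K"
  shows "inj_on (\<lambda>k. (a + k) mod q) K"
  using assms cong_add_lcancel_nat[of a _ _ q] unfolding inj_on_def cong_def by blast

lemma inj_on_mod_lessThan: "inj_on (\<lambda>k. k mod q) {..<q}" for q :: nat
  by (auto simp: inj_on_def)

text \<open>
  The window \<open>{1..q}\<close> is also a system of residues. It is what allows the second block to be
  one shorter than the first when the rotation by \<open>0\<close> is left out.
\<close>

lemma inj_on_mod_atLeast1AtMost: "inj_on (\<lambda>k. k mod q) {1..q}" for q :: nat
proof (rule inj_onI)
  fix x y assume "x \<in> {1..q}" "y \<in> {1..q}" "x mod q = y mod q"
  then show "x = y"
    by (cases "x = q"; cases "y = q") auto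
qed

lemma bij_betw_shift_mod:
  fixes a q :: nat
  shows "bij_betw (\<lambda>k. (a + k) mod q) {..<q} {..<q}"
proof -
  have inj: "inj_on (\<lambda>k. (a + k) mod q) {..<q}"
    by (intro inj_on_shift_mod inj_on_mod_lessThan)
  moreover have "(\<lambda>k. (a + k) mod q) ` {..<q} \<subseteq> {..<q}" by auto
  ultimately show ?thesis
    by (simp add: bij_betw_def endo_inj_surj)
qed

definition rotate_blocks :: "nat \<Rightarrow> nat \<Rightarrow> nat \<Rightarrow> nat \<Rightarrow> nat" where
  "rotate_blocks m n k i = (if i < m then (k + i) mod m else m + (k + (i - m)) mod (n - m))"

lemma bij_betw_rotate_blocks:
  assumes "m \<le> n"
  shows "bij_betw (rotate_blocks m n k) {..<n} {..<n}"
proof -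
  have "bij_betw (rotate_blocks m n k) {..<m} {..<m}"
    using bij_betw_shift_mod[of k m]
    by (subst bij_betw_cong[where g = "\<lambda>i. (k + i) mod m"]) (auto simp: rotate_blocks_def)
  moreover have "bij_betw (rotate_blocks m n k) {m..<n} {m..<n}"
  proof -
    have "bij_betw (\<lambda>i. i - m) {m..<n} {..<n - m}"
      by (rule bij_betw_byWitness[of _ "\<lambda>i. i + m"]) auto
    moreover have "bij_betw (\<lambda>i. m + i) {..<n - m} {m..<n}"
      by (rule bij_betw_byWitness[of _ "\<lambda>i. i - m"]) auto
    ultimately have "bij_betw ((\<lambda>i. m + i) \<circ> ((\<lambda>i. (k + i) mod (n - m)) \<circ> (\<lambda>i. i - m))) {m..<n} {m..<n}"
      using bij_betw_shift_mod[of k "n - m"] by (intro bij_betw_trans)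
    then show ?thesis
      by (subst bij_betw_cong) (auto simp: rotate_blocks_def)
  qed
  ultimately have "bij_betw (rotate_blocks m n k) ({..<m} \<union> {m..<n}) ({..<m} \<union> {m..<n})"
    by (rule bij_betw_combine) auto
  then show ?thesis
    using assms by (simp add: ivl_disj_un)
qed

text \<open>
  If \<open>m = n\<close>, the second block is empty and the condition modulo \<open>n - m\<close> should be vacuous. It is,
  because \<open>k mod 0 = k\<close>; so the circulant case needs no separate treatment.
\<close>

lemma inj_on_rotate_blocks:
  assumes "K \<subseteq> {..<m}" and "inj_on (\<lambda>k. k mod (n - m)) K"
  shows "inj_on (\<lambda>k. rotate_blocks m n k i) K"
proof (cases "i < m")
  case True
  have "inj_on (\<lambda>k. (i + k) mod m) K"
    using inj_on_shift_mod[OF inj_on_subset[OF inj_on_mod_lessThan assms(1)]] .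
  then show ?thesis using True by (simp add: rotate_blocks_def add.commute)
next
  case False
  have "inj_on (\<lambda>k. ((i - m) + k) mod (n - m)) K"
    using inj_on_shift_mod[OF assms(2)] .
  then show ?thesis using False by (simp add: rotate_blocks_def add.commute inj_on_def)
qed

lemma power_mod_root_of_unity:
  fixes w :: "'a::monoid_mult"
  assumes "w ^ m = 1"
  shows "w ^ (k mod m) = w ^ k"
proof -
  have "w ^ k = w ^ (m * (k div m) + k mod m)" by simp
  also have "\<dots> = w ^ (k mod m)" unfolding power_add power_mult assms by simp
  finally show ?thesis ..
qed

text \<open>
  On the first block, \<open>i \<mapsto> w ^ i\<close> is a character of the cyclic group of order \<open>m\<close>, so rotation by
  \<open>k\<close> multiplies it by \<open>w ^ k\<close>. Extended by zero, it is a common eigenvector of all the rotations,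
  because these preserve the two blocks.
\<close>

lemma root_mixture_eigenvalue:
  assumes m: "0 < m" "m \<le> n" and K: "K \<subseteq> {..<m}" and inj: "inj_on (\<lambda>k. k mod (n - m)) K"
    and w: "w ^ m = 1"
    and c: "\<And>k. k \<in> K \<Longrightarrow> c k \<ge> 0" "sum c K = 1"
  shows "(\<Sum>k\<in>K. of_real (c k) * w ^ k) \<in> eigenvalue_region (PDS n)"
proof (rule permutation_mixture_eigenvalue[where K = K and \<sigma> = "rotate_blocks m n" and c = c
      and v = "\<lambda>i. if i < m then w ^ i else 0" and ?i0.0 = 0])
  show "finite K" using K finite_subset by blast
  show "(\<Sum>k\<in>K. of_real (c k) * (if rotate_blocks m n k i < m then w ^ rotate_blocks m n k i else 0))
      = (\<Sum>k\<in>K. of_real (c k) * w ^ k) * (if i < m then w ^ i else 0)" for i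
    using m by (auto simp: rotate_blocks_def power_mod_root_of_unity[OF w] power_add
        sum_distrib_right mult.assoc)
qed (use assms bij_betw_rotate_blocks inj_on_rotate_blocks in auto)

section \<open>Hulls of roots of unity\<close>

lemma convex_hull_root_powers:
  fixes w :: complex
  assumes K: "finite K" and inj: "inj_on (\<lambda>k. w ^ k) K" and z: "z \<in> convex hull ((\<lambda>k. w ^ k) ` K)"
  obtains c :: "nat \<Rightarrow> real"
    where "\<And>k. k \<in> K \<Longrightarrow> c k \<ge> 0" "sum c K = 1" "z = (\<Sum>k\<in>K. of_real (c k) * w ^ k)"
proof -
  obtain u where u: "\<forall>x\<in>(\<lambda>k. w ^ k) ` K. 0 \<le> u x" "sum u ((\<lambda>k. w ^ k) ` K) = 1"
      "(\<Sum>x\<in>(\<lambda>k. w ^ k) ` K. u x *\<^sub>R x) = z"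
    using z K by (auto simp: convex_hull_finite)
  show thesis
    using u inj by (intro that[of "\<lambda>k. u (w ^ k)"]) (auto simp: sum.reindex scaleR_conv_of_real)
qed

lemma roots_of_unity_powers:
  assumes "m > 0"
  obtains w :: complex
    where "w ^ m = 1" "bij_betw (\<lambda>k. w ^ k) {..<m} {z. z ^ m = 1}"
proof
  let ?w = "cis (2 * pi / real m)"
  have pow: "?w ^ k = cis (2 * pi * real k / real m)" for k
    by (simp add: DeMoivre mult.commute)
  show "?w ^ m = 1" using assms by (simp add: pow)
  show "bij_betw (\<lambda>k. ?w ^ k) {..<m} {z. z ^ m = 1}"
    using bij_betw_roots_unity[OF assms] by (simp add: pow)
qed

lemma roots_hull_subset:
  assumes m: "0 < m" and n: "m = n \<or> 2 * m \<le> n"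
  shows "roots_hull m \<subseteq> eigenvalue_region (PDS n)"
proof
  fix z assume "z \<in> roots_hull m"
  moreover obtain w :: complex where w: "w ^ m = 1" "bij_betw (\<lambda>k. w ^ k) {..<m} {z. z ^ m = 1}"
    using roots_of_unity_powers[OF m] .
  ultimately have "z \<in> convex hull ((\<lambda>k. w ^ k) ` {..<m})"
    by (simp add: roots_hull_def bij_betw_def)
  then obtain c where "\<And>k. k \<in> {..<m} \<Longrightarrow> c k \<ge> 0" "sum c {..<m} = 1"
      and z: "z = (\<Sum>k<m. of_real (c k) * w ^ k)"
    using convex_hull_root_powers[of "{..<m}" w z] w(2) by (auto simp: bij_betw_def)
  moreover have "inj_on (\<lambda>k. k mod (n - m)) {..<m}"
    using n by (auto simp: inj_on_def)
  ultimately show "z \<in> eigenvalue_region (PDS n)"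
    unfolding z using m n w(1) by (intro root_mixture_eigenvalue[where m = m]) auto
qed

lemma nontrivial_roots_hull_subset:
  assumes m: "2 \<le> m" and n: "2 * m - 1 \<le> n"
  shows "convex hull {z. z ^ m = 1 \<and> z \<noteq> 1} \<subseteq> eigenvalue_region (PDS n)"
proof
  fix z :: complex assume z: "z \<in> convex hull {z. z ^ m = 1 \<and> z \<noteq> 1}"
  obtain w :: complex where w: "w ^ m = 1" "bij_betw (\<lambda>k. w ^ k) {..<m} {z. z ^ m = 1}"
    using roots_of_unity_powers[of m] m by auto
  \<comment> \<open>The root \<open>1\<close> is the power with exponent \<open>0\<close>, so removing it leaves the exponents \<open>{1..<m}\<close>.\<close>
  have K: "{1..<m} = {..<m} - {0}" by auto
  have "(\<lambda>k. w ^ k) ` {1..<m} = (\<lambda>k. w ^ k) ` {..<m} - {w ^ 0}"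
    unfolding K using w(2) m by (subst inj_on_image_set_diff[where C = "{..<m}"]) (auto simp: bij_betw_def)
  also have "\<dots> = {z. z ^ m = 1 \<and> z \<noteq> 1}"
    using w(2) by (auto simp: bij_betw_def)
  finally have "z \<in> convex hull ((\<lambda>k. w ^ k) ` {1..<m})"
    using z by simp
  moreover have "inj_on (\<lambda>k. w ^ k) {1..<m}"
    using w(2) by (auto simp: bij_betw_def intro: inj_on_subset)
  ultimately obtain c where "\<And>k. k \<in> {1..<m} \<Longrightarrow> c k \<ge> 0" "sum c {1..<m} = 1"
      and z: "z = (\<Sum>k\<in>{1..<m}. of_real (c k) * w ^ k)"
    using convex_hull_root_powers[of "{1..<m}" w z] by blast
  moreover have "inj_on (\<lambda>k. k mod (n - m)) {1..<m}"
    using n by (intro inj_on_subset[OF inj_on_mod_atLeast1AtMost]) auto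
  ultimately show "z \<in> eigenvalue_region (PDS n)"
    unfolding z using m n w(1) by (intro root_mixture_eigenvalue[where m = m]) auto
qed

section \<open>The real interval\<close>

text \<open>
  The hull of the \<open>n\<close>-th roots of unity misses \<open>-1\<close> if \<open>n\<close> is odd, which is why rotations do not
  suffice here. To see \<open>\<bar>x\<bar> P(\<tau>) + (1 - \<bar>x\<bar>) J / n\<close> as a mixture with disjoint
  supports, write \<open>J\<close> as the sum of the matrices of \<open>i \<mapsto> (k + \<tau> i) mod n\<close> over \<open>k < n\<close>, among which
  \<open>k = 0\<close> gives \<open>P(\<tau>)\<close> itself.
\<close>

lemma real_interval_subset:
  assumes n: "2 \<le> n" and x: "x \<in> {-1..1}"
  shows "complex_of_real x \<in> eigenvalue_region (PDS n)"
proof -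
  define \<tau> :: "nat \<Rightarrow> nat" where "\<tau> = (if 0 \<le> x then id else Transposition.transpose 0 1)"
  define v :: "nat \<Rightarrow> complex" where "v i = (if i = 0 then 1 else if i = 1 then - 1 else 0)" for i
  define c :: "nat \<Rightarrow> real" where "c k = (1 - \<bar>x\<bar>) / n + (if k = 0 then \<bar>x\<bar> else 0)" for k
  have \<tau>: "bij_betw \<tau> {..<n} {..<n}"
    using n by (auto simp: \<tau>_def bij_betw_id intro!: permutes_imp_bij permutes_swap_id)
  then have \<tau>_less: "\<tau> i < n" if "i < n" for i
    using that by (auto simp: bij_betw_def)
  have v\<tau>: "\<bar>x\<bar> * v (\<tau> i) = x * v i" for i
    by (auto simp: \<tau>_def v_def Transposition.transpose_def)
  have v_sum: "(\<Sum>j<n. v j) = 0"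
  proof -
    have "(\<Sum>j<n. v j) = (\<Sum>j\<in>{0, 1}. v j)"
      using n by (intro sum.mono_neutral_right) (auto simp: v_def)
    then show ?thesis by (simp add: v_def)
  qed
  show ?thesis
  proof (rule permutation_mixture_eigenvalue[where K = "{..<n}" and c = c and v = v and ?i0.0 = 0
        and \<sigma> = "\<lambda>k i. (k + \<tau> i) mod n"])
    show "bij_betw (\<lambda>i. (k + \<tau> i) mod n) {..<n} {..<n}" for k
      using bij_betw_trans[OF \<tau> bij_betw_shift_mod[of k]] by (simp add: comp_def)
    show "inj_on (\<lambda>k. (k + \<tau> i) mod n) {..<n}" for i
      using bij_betw_shift_mod[of "\<tau> i" n] by (simp add: bij_betw_def add.commute)
    show "0 \<le> c k" for k using x by (auto simp: c_def)
    show "sum c {..<n} = 1"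
      using n by (simp add: c_def sum.distrib)
    show "(\<Sum>k<n. of_real (c k) * v ((k + \<tau> i) mod n)) = of_real x * v i" if i: "i < n" for i
    proof -
      have shift: "(\<Sum>k<n. v ((k + \<tau> i) mod n)) = 0"
        using sum.reindex_bij_betw[OF bij_betw_shift_mod[of "\<tau> i" n], of v] v_sum
        by (simp add: add.commute)
      have "(\<Sum>k<n. of_real (c k) * v ((k + \<tau> i) mod n))
          = (\<Sum>k<n. of_real ((1 - \<bar>x\<bar>) / n) * v ((k + \<tau> i) mod n)
                + (if k = 0 then of_real \<bar>x\<bar> * v ((k + \<tau> i) mod n) else 0))"
        by (intro sum.cong) (auto simp: c_def distrib_right)
      also have "\<dots> = of_real \<bar>x\<bar> * v (\<tau> i)"
        using n \<tau>_less[OF i] unfolding sum.distrib sum_distrib_left[symmetric] shift by simp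
      finally show ?thesis using v\<tau> by simp
    qed
  qed (use n in \<open>auto simp: v_def\<close>)
qed

theorem theorem3p16:
  fixes n :: nat
  assumes "n \<ge> 3"
  shows "complex_of_real ` {-1..1} \<union> (\<Union>m\<in>{3..n div 2}. roots_hull m)
           \<union> roots_hull0 ((n + 1) div 2) \<union> roots_hull n
         \<subseteq> eigenvalue_region (PDS n)"
proof -
  have interval: "complex_of_real ` {-1..1} \<subseteq> eigenvalue_region (PDS n)"
    using real_interval_subset assms by auto
  have "roots_hull m \<subseteq> eigenvalue_region (PDS n)" if "m \<in> {3..n div 2}" for m
    using that by (intro roots_hull_subset) auto
  moreover have "roots_hull0 ((n + 1) div 2) \<subseteq> eigenvalue_region (PDS n)"
  proof -
    have "1 \<in> eigenvalue_region (PDS n)"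
      using real_interval_subset[of n 1] assms by simp
    moreover have "convex hull {z. z ^ ((n + 1) div 2) = 1 \<and> z \<noteq> 1} \<subseteq> eigenvalue_region (PDS n)"
      using assms by (intro nontrivial_roots_hull_subset) auto
    ultimately show ?thesis by (auto simp: roots_hull0_def)
  qed
  moreover have "roots_hull n \<subseteq> eigenvalue_region (PDS n)"
    using assms by (intro roots_hull_subset) auto
  ultimately show ?thesis using interval by blast
qed

end
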